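(* For every integer $k\ge 4$, every positive integer $n$ is a sum of $k$ nonzero generalized pentagonal numbers, except for $n=1,2,\ldots,k-1$.
   Context: A generalized pentagonal number is a number of the form $P_5(x)=\frac{3x^2-x}{2}$ with $x\in\mathbb{Z}$; it is nonzero iff $x\neq 0$. *)

theory Defs
  imports Complex_Main
begin

definition P5 :: "int \<Rightarrow> int" where
  "P5 x = (3 * x^2 - x) div 2"

text \<open>The integer division in the definition of \<open>P5\<close> is exact.\<close>

lemma two_times_P5: "2 * P5 x = 3 * x^2 - x"
proof -
  have "even (3 * x^2 - x)" by simp
  then show ?thesis unfolding P5_def by simp
qed

definition generalized_pentagonal :: "int \<Rightarrow> bool" where
  "generalized_pentagonal m \<longleftrightarrow> (\<exists>x::int. m = P5 x)"

definition sum_of_nonzero_generalized_pentagonals :: "nat \<Rightarrow> int \<Rightarrow> bool" where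
  "sum_of_nonzero_generalized_pentagonals k n \<longleftrightarrow>
     (\<exists>a :: nat \<Rightarrow> int.
        (\<forall>i<k. generalized_pentagonal (a i) \<and> a i \<noteq> 0) \<and> n = (\<Sum>i<k. a i))"

end

theory Submission
  imports Defs "HOL-Computational_Algebra.Primes"
begin

text \<open>
  Since $24 P_5(x) + 1 = (6x-1)^2$, a representation of $n$ as a sum of four generalized pentagonal
  numbers is a representation of $24n+4$ as a sum of four squares prime to 6. Such a representation
  exists: write $6n+1 = a^2+b^2+c^2+d^2$ by Lagrange's theorem, with signs such that each variable is
  0 or 1 modulo 3, and take $a+b+c-d$, $a+b-c+d$, $a-b+c+d$, $-a+b+c+d$.

  To get rid of zero summands, we move between representations of the same $n$ by reflections of the
  vector $(6x-1, 6y-1, 6z-1, 6w-1)$ in $(1,1,1,0)$ and in $(1,1,1,\pm 3)$. Starting from a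
  representation with $w = 0$ and $x, y, z \neq 0$, such a reflection again has a zero summand only if
  $x, y, z$ satisfy one of a few linear equations. Solving these for the three pairs of variables
  leaves a bounded set of triples and six lines; one further reflection disposes of the lines, so
  only small $n$ remain. Larger $k$ follows from $k = 4$ by adding $1 = P_5(1)$.
\<close>

section \<open>Lagrange's four-square theorem\<close>

definition sum4sq :: "int \<Rightarrow> bool" where
  "sum4sq n \<longleftrightarrow> (\<exists>a b c d. n = a\<^sup>2 + b\<^sup>2 + c\<^sup>2 + d\<^sup>2)"

lemma euler_four_square:
  fixes a b c d x y z w :: "'a :: comm_ring_1"
  shows "(a\<^sup>2 + b\<^sup>2 + c\<^sup>2 + d\<^sup>2) * (x\<^sup>2 + y\<^sup>2 + z\<^sup>2 + w\<^sup>2) =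
    (a*x + b*y + c*z + d*w)\<^sup>2 + (a*y - b*x + c*w - d*z)\<^sup>2 +
    (a*z - b*w - c*x + d*y)\<^sup>2 + (a*w + b*z - c*y - d*x)\<^sup>2"
  by (simp add: power2_eq_square algebra_simps)

lemma sum4sq_mult: "sum4sq m \<Longrightarrow> sum4sq n \<Longrightarrow> sum4sq (m * n)"
  unfolding sum4sq_def using euler_four_square by metis

text \<open>The prime divides \<open>a - b\<close> or \<open>a + b\<close>. In this range
  \<open>\<bar>a - b\<bar> < p\<close>, and \<open>a + b < p\<close> once \<open>a\<close> and
  \<open>b\<close> differ, which covers \<open>p = 2\<close> too.\<close>

lemma inj_on_square_mod_prime:
  fixes p :: int
  assumes "prime p"
  shows "inj_on (\<lambda>a. a\<^sup>2 mod p) {0..p div 2}"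
proof (rule inj_onI)
  fix a b assume ab: "a \<in> {0..p div 2}" "b \<in> {0..p div 2}" and eq: "a\<^sup>2 mod p = b\<^sup>2 mod p"
  have p: "p > 1" using assms prime_gt_1_int by blast
  have "p dvd (a - b) * (a + b)"
    using eq by (simp add: mod_eq_dvd_iff power2_eq_square algebra_simps)
  then have "p dvd a - b \<or> p dvd a + b" using assms prime_dvd_mult_iff by blast
  then show "a = b"
  proof
    assume "p dvd a - b"
    moreover have "\<bar>a - b\<bar> < p" using ab p by auto
    ultimately show ?thesis using zdvd_not_zless[of "\<bar>a - b\<bar>" p] by auto
  next
    assume d: "p dvd a + b"
    show ?thesis
    proof (rule ccontr)
      assume "a \<noteq> b"
      then have "0 < a + b" "a + b < p" using ab by auto
      then show False using d zdvd_imp_le by fastforce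
    qed
  qed
qed

text \<open>Pigeonhole: \<open>a\<^sup>2\<close> and \<open>- 1 - b\<^sup>2\<close> each take
  \<open>p div 2 + 1\<close> values among only \<open>p\<close> residues, so they share one. The
  bounds on \<open>a\<close> and \<open>b\<close> later keep the cofactor of \<open>p\<close> below
  \<open>p\<close>.\<close>

lemma prime_dvd_sum_two_squares_plus_1:
  fixes p :: int
  assumes "prime p"
  obtains a b where "0 \<le> a" "a \<le> p div 2" "0 \<le> b" "b \<le> p div 2" "p dvd a\<^sup>2 + b\<^sup>2 + 1"
proof -
  have p: "p > 1" using assms prime_gt_1_int by blast
  let ?H = "{0..p div 2}"
  let ?A = "(\<lambda>a. a\<^sup>2 mod p) ` ?H" and ?B = "(\<lambda>b. (- 1 - b\<^sup>2) mod p) ` ?H"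
  have inj: "inj_on (\<lambda>b. (- 1 - b\<^sup>2) mod p) ?H"
  proof (rule inj_onI)
    fix a b assume "a \<in> ?H" "b \<in> ?H" "(- 1 - a\<^sup>2) mod p = (- 1 - b\<^sup>2) mod p"
    then show "a = b"
      using inj_on_square_mod_prime[OF assms]
      by (auto simp: mod_eq_dvd_iff inj_on_def dvd_diff_commute)
  qed
  have "?A \<inter> ?B \<noteq> {}"
  proof
    assume disj: "?A \<inter> ?B = {}"
    have "card (?A \<union> ?B) = card ?A + card ?B" by (rule card_Un_disjoint) (use disj in auto)
    also have "\<dots> = 2 * card ?H"
      by (simp only: card_image[OF inj_on_square_mod_prime[OF assms]] card_image[OF inj])
    also have "\<dots> = 2 * nat (p div 2 + 1)" by (simp only: card_atLeastAtMost_int diff_zero)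
    also have "\<dots> > nat p" using p by linarith
    finally have "card (?A \<union> ?B) > nat p" .
    moreover have "?A \<union> ?B \<subseteq> {0..<p}" using p by auto
    then have "card (?A \<union> ?B) \<le> card {0..<p}" by (intro card_mono) auto
    ultimately show False by simp
  qed
  then obtain q where "q \<in> ?A" "q \<in> ?B" by blast
  then obtain a b where ab: "a \<in> ?H" "b \<in> ?H" "a\<^sup>2 mod p = (- 1 - b\<^sup>2) mod p"
    by (elim imageE) simp
  then have "p dvd a\<^sup>2 - (- 1 - b\<^sup>2)" using mod_eq_dvd_iff by blast
  moreover have "a\<^sup>2 - (- 1 - b\<^sup>2) = a\<^sup>2 + b\<^sup>2 + 1" by simp
  ultimately have "p dvd a\<^sup>2 + b\<^sup>2 + 1" by (simp only:)
  with ab show thesis by (intro that[of a b]) simp_all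
qed

text \<open>Here \<open>c\<close> is \<open>x / m\<close> rounded to a nearest integer. For even
  \<open>m\<close> the bound can be attained, which is why the descent has to exclude
  \<open>r = m\<close>.\<close>

lemma symmetric_residue:
  fixes x m :: int
  assumes "m > 0"
  obtains c y where "x = y + m * c" "2 * \<bar>y\<bar> \<le> m"
proof -
  let ?c = "(2 * x + m) div (2 * m)"
  have "2 * x + m = 2 * m * ?c + (2 * x + m) mod (2 * m)" by simp
  moreover have "0 \<le> (2 * x + m) mod (2 * m)" "(2 * x + m) mod (2 * m) < 2 * m"
    using assms by auto
  ultimately have "2 * \<bar>x - m * ?c\<bar> \<le> m" by (auto simp: abs_if algebra_simps)
  then show thesis by (intro that[of "x - m * ?c" ?c]) auto
qed

text \<open>Lagrange's descent: replace the four roots by their residues of least absolute value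
  modulo \<open>m\<close>, with square sum \<open>m * r\<close>. Euler's identity writes
  \<open>(m * p) * (m * r)\<close> as a sum of squares of four multiples of \<open>m\<close>, and
  \<open>m\<^sup>2\<close> cancels. Both \<open>r = 0\<close> and \<open>r = m\<close> would force
  \<open>m dvd p\<close>.\<close>

lemma four_square_descent:
  fixes p m :: int
  assumes "prime p" "1 < m" "m < p" "sum4sq (m * p)"
  shows "\<exists>r. 0 < r \<and> r < m \<and> sum4sq (r * p)"
proof -
  obtain x1 x2 x3 x4 where x: "m * p = x1\<^sup>2 + x2\<^sup>2 + x3\<^sup>2 + x4\<^sup>2"
    using assms(4) unfolding sum4sq_def by blast
  have m0: "m > 0" using assms by simp
  obtain c1 y1 where 1: "x1 = y1 + m * c1" "2 * \<bar>y1\<bar> \<le> m" by (rule symmetric_residue[OF m0])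
  obtain c2 y2 where 2: "x2 = y2 + m * c2" "2 * \<bar>y2\<bar> \<le> m" by (rule symmetric_residue[OF m0])
  obtain c3 y3 where 3: "x3 = y3 + m * c3" "2 * \<bar>y3\<bar> \<le> m" by (rule symmetric_residue[OF m0])
  obtain c4 y4 where 4: "x4 = y4 + m * c4" "2 * \<bar>y4\<bar> \<le> m" by (rule symmetric_residue[OF m0])
  define C where "C = 2 * (c1*y1 + c2*y2 + c3*y3 + c4*y4)"
  \<comment> \<open>The square sum of the residues divided by \<open>m\<close>, expanded so that no
    division occurs.\<close>
  define r where "r = p - C - m * (c1\<^sup>2 + c2\<^sup>2 + c3\<^sup>2 + c4\<^sup>2)"
  have "m * r = m * p - m * C - m * m * (c1\<^sup>2 + c2\<^sup>2 + c3\<^sup>2 + c4\<^sup>2)"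
    by (simp add: r_def algebra_simps)
  also have "\<dots> = y1\<^sup>2 + y2\<^sup>2 + y3\<^sup>2 + y4\<^sup>2"
    unfolding x 1 2 3 4 C_def by (simp add: power2_eq_square algebra_simps)
  finally have y: "m * r = y1\<^sup>2 + y2\<^sup>2 + y3\<^sup>2 + y4\<^sup>2" .
  have not_dvd: "\<not> m dvd p"
  proof
    assume "m dvd p"
    then have "m = 1 \<or> m = p" using assms(1) m0 by (simp add: prime_int_iff)
    then show False using assms(2,3) by simp
  qed
  have sq: "4 * u\<^sup>2 \<le> m\<^sup>2" "4 * u\<^sup>2 = m\<^sup>2 \<Longrightarrow> m dvd 2 * u" if "2 * \<bar>u\<bar> \<le> m" for u
  proof -
    have "\<bar>2 * u\<bar> \<le> m" using that by simp
    then have "(2 * u)\<^sup>2 \<le> m\<^sup>2" using abs_le_square_iff[of "2 * u" m] m0 by simp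
    then show "4 * u\<^sup>2 \<le> m\<^sup>2" by (simp add: power_mult_distrib)
    assume "4 * u\<^sup>2 = m\<^sup>2"
    then have "(2 * u)\<^sup>2 = m\<^sup>2" by (simp add: power_mult_distrib)
    then have "2 * u = m \<or> 2 * u = - m" by (simp only: power2_eq_iff)
    then show "m dvd 2 * u" by auto
  qed
  have "0 \<le> m * r" unfolding y by simp
  then have "0 \<le> r" using m0 by (simp add: zero_le_mult_iff)
  moreover have "r \<noteq> 0"
  proof
    assume "r = 0"
    then have "y1\<^sup>2 + y2\<^sup>2 + y3\<^sup>2 + y4\<^sup>2 = 0" using y by simp
    then have "y1 = 0 \<and> y2 = 0 \<and> y3 = 0 \<and> y4 = 0"
      by (simp add: add_nonneg_eq_0_iff)
    then have "p = m * (c1\<^sup>2 + c2\<^sup>2 + c3\<^sup>2 + c4\<^sup>2)" using \<open>r = 0\<close> by (simp add: r_def C_def)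
    then show False using not_dvd by simp
  qed
  moreover have "r < m"
  proof (rule ccontr)
    assume "\<not> r < m"
    then have "m\<^sup>2 \<le> m * r" using m0 by (simp add: power2_eq_square)
    \<comment> \<open>Four squares, each at most a quarter of \<open>m\<^sup>2\<close>, add up to
      \<open>m\<^sup>2\<close> or more only if all attain that bound.\<close>
    then have eq: "4 * y1\<^sup>2 = m\<^sup>2" "4 * y2\<^sup>2 = m\<^sup>2" "4 * y3\<^sup>2 = m\<^sup>2" "4 * y4\<^sup>2 = m\<^sup>2" "m * r = m\<^sup>2"
      using y sq(1)[OF 1(2)] sq(1)[OF 2(2)] sq(1)[OF 3(2)] sq(1)[OF 4(2)] by linarith+
    then have "r = m" using m0 by (simp add: power2_eq_square)
    have "C = c1 * (2*y1) + c2 * (2*y2) + c3 * (2*y3) + c4 * (2*y4)" by (simp add: C_def)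
    also have "m dvd \<dots>"
      by (intro dvd_add dvd_mult sq(2)[OF 1(2) eq(1)] sq(2)[OF 2(2) eq(2)] sq(2)[OF 3(2) eq(3)]
        sq(2)[OF 4(2) eq(4)])
    finally have "m dvd C" .
    moreover have "p = m + C + m * (c1\<^sup>2 + c2\<^sup>2 + c3\<^sup>2 + c4\<^sup>2)" using \<open>r = m\<close> by (simp add: r_def)
    ultimately show False using not_dvd by (metis dvd_add dvd_refl dvd_triv_left)
  qed
  moreover have "sum4sq (r * p)"
  proof -
    \<comment> \<open>The four bilinear forms of \<open>euler_four_square\<close>, already divided
      by \<open>m\<close>.\<close>
    let ?z1 = "r + c1*y1 + c2*y2 + c3*y3 + c4*y4"
    let ?z2 = "c1*y2 - c2*y1 + c3*y4 - c4*y3"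
    let ?z3 = "c1*y3 - c2*y4 - c3*y1 + c4*y2"
    let ?z4 = "c1*y4 + c2*y3 - c3*y2 - c4*y1"
    have "x1*y1 + x2*y2 + x3*y3 + x4*y4 =
        y1\<^sup>2 + y2\<^sup>2 + y3\<^sup>2 + y4\<^sup>2 + m * (c1*y1 + c2*y2 + c3*y3 + c4*y4)"
      unfolding 1 2 3 4 by (simp add: power2_eq_square algebra_simps)
    then have "x1*y1 + x2*y2 + x3*y3 + x4*y4 = m * ?z1"
      unfolding y[symmetric] by (simp add: distrib_left)
    moreover have "x1*y2 - x2*y1 + x3*y4 - x4*y3 = m * ?z2" "x1*y3 - x2*y4 - x3*y1 + x4*y2 = m * ?z3"
      "x1*y4 + x2*y3 - x3*y2 - x4*y1 = m * ?z4"
      unfolding 1 2 3 4 by (simp_all add: algebra_simps)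
    ultimately have "(m * p) * (m * r) = (m * ?z1)\<^sup>2 + (m * ?z2)\<^sup>2 + (m * ?z3)\<^sup>2 + (m * ?z4)\<^sup>2"
      unfolding x y by (simp only: euler_four_square)
    then have "m\<^sup>2 * (r * p) = m\<^sup>2 * (?z1\<^sup>2 + ?z2\<^sup>2 + ?z3\<^sup>2 + ?z4\<^sup>2)"
      unfolding power_mult_distrib distrib_left[symmetric]
      by (simp only: power2_eq_square[of m] ac_simps)
    then have "r * p = ?z1\<^sup>2 + ?z2\<^sup>2 + ?z3\<^sup>2 + ?z4\<^sup>2" using m0 by simp
    then show ?thesis unfolding sum4sq_def by blast
  qed
  ultimately show ?thesis by (intro exI[of _ r]) auto
qed

lemma sum4sq_prime:
  fixes p :: int
  assumes "prime p"
  shows "sum4sq p"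
proof -
  have p: "p > 1" using assms prime_gt_1_int by blast
  have descent: "sum4sq p" if "0 < m" "m < p" "sum4sq (m * p)" for m
    using that
  proof (induction "nat m" arbitrary: m rule: less_induct)
    case less
    show ?case
    proof (cases "m = 1")
      case True
      then show ?thesis using less by simp
    next
      case False
      then obtain r where "0 < r" "r < m" "sum4sq (r * p)"
        using four_square_descent[OF assms, of m] less.prems by auto
      then show ?thesis using less by auto
    qed
  qed
  obtain a b where ab: "0 \<le> a" "a \<le> p div 2" "0 \<le> b" "b \<le> p div 2" "p dvd a\<^sup>2 + b\<^sup>2 + 1"
    by (rule prime_dvd_sum_two_squares_plus_1[OF assms])
  then obtain m where m: "a\<^sup>2 + b\<^sup>2 + 1 = m * p" by (metis dvd_def mult.commute)
  show ?thesis
  proof (rule descent)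
    have "a\<^sup>2 + b\<^sup>2 + 1 > 0" by (smt (verit) zero_le_power2)
    then show "0 < m" using m p by (simp add: zero_less_mult_iff)
    have "(2 * a)\<^sup>2 \<le> p\<^sup>2" "(2 * b)\<^sup>2 \<le> p\<^sup>2"
      by (rule power_mono; use ab in linarith)+
    then have "4 * (m * p) \<le> 2 * p\<^sup>2 + 4" unfolding m[symmetric] by (simp add: power_mult_distrib)
    \<comment> \<open>Together with the previous estimate this gives
      \<open>4 * (m * p) \<le> 3 * p\<^sup>2\<close>.\<close>
    moreover have "2 * 2 \<le> p * p" using p by (intro mult_mono) auto
    ultimately have "m * p < p * p" unfolding power2_eq_square by linarith
    then show "m < p" using p by simp
    have "m * p = a\<^sup>2 + b\<^sup>2 + 1\<^sup>2 + 0\<^sup>2" using m by simp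
    then show "sum4sq (m * p)" unfolding sum4sq_def by blast
  qed
qed

theorem four_squares: "sum4sq (int n)"
proof (induction n rule: less_induct)
  case (less n)
  consider "n = 0" | "n = 1" | "n > 1" by linarith
  then show ?case
  proof cases
    case 1
    then have "int n = 0\<^sup>2 + 0\<^sup>2 + 0\<^sup>2 + 0\<^sup>2" by simp
    then show ?thesis unfolding sum4sq_def by blast
  next
    case 2
    then have "int n = 1\<^sup>2 + 0\<^sup>2 + 0\<^sup>2 + 0\<^sup>2" by simp
    then show ?thesis unfolding sum4sq_def by blast
  next
    case 3
    then obtain p k where p: "prime p" "n = p * k" using prime_factor_nat[of n] by (auto simp: dvd_def)
    then have "k < n" using 3 prime_gt_1_nat[of p] by (cases "k = 0") auto
    then have "sum4sq (int k)" by (rule less.IH)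
    moreover have "sum4sq (int p)" using p by (intro sum4sq_prime) simp
    ultimately show ?thesis using p sum4sq_mult by simp
  qed
qed

section \<open>Reflections of pentagonal representations\<close>

lemma P5_nonneg: "0 \<le> P5 x"
  and P5_eq_0_iff: "P5 x = 0 \<longleftrightarrow> x = 0"
proof -
  have "x \<le> x\<^sup>2" by (cases "x \<le> 0") (auto simp: power2_eq_square mult_le_cancel_left1 intro: order_trans[OF _ zero_le_square])
  then have *: "x\<^sup>2 \<le> P5 x" using two_times_P5[of x] by linarith
  then show "0 \<le> P5 x" by (rule order_trans[OF zero_le_power2])
  show "P5 x = 0 \<longleftrightarrow> x = 0"
  proof
    assume "P5 x = 0"
    then have "x\<^sup>2 = 0" using * zero_le_power2[of x] by linarith
    then show "x = 0" by simp
  qed (simp add: P5_def)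
qed

text \<open>The maximum is \<open>P5 (- 10)\<close>. Three such summands give the bound 465 that
  recurs below.\<close>

lemma P5_le:
  assumes "- 10 \<le> x" "x \<le> 10"
  shows "P5 x \<le> 155"
proof -
  have "\<bar>x\<bar> \<le> \<bar>10\<bar>" using assms by simp
  then have "x\<^sup>2 \<le> 10\<^sup>2" by (simp only: abs_le_square_iff)
  then show ?thesis using two_times_P5[of x] assms by simp
qed

lemma int_mod3_cases:
  fixes x :: int
  obtains u where "x = 3*u" | u where "x = 3*u + 1" | u where "x = 3*u + 2"
proof -
  have "x mod 3 = 0 \<or> x mod 3 = 1 \<or> x mod 3 = 2" by presburger
  then show thesis using that by (metis mult_div_mod_eq add.right_neutral)
qed

text \<open>
  The reflections in $(1,1,1,0)$ and $(1,1,1,\pm 3)$ in terms of $x$ instead of $6x-1$. They preserve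
  integrality only in some residue classes, and there up to the sign of $6x-1$, hence the two
  formulas in each case.
\<close>

lemma P5_reflect3:
  "x + y + z = 3 * t \<Longrightarrow> P5 (2*t - x) + P5 (2*t - y) + P5 (2*t - z) = P5 x + P5 y + P5 z"
  "x + y + z = 3 * t + 2 \<Longrightarrow>
    P5 (x - 2*t - 1) + P5 (y - 2*t - 1) + P5 (z - 2*t - 1) = P5 x + P5 y + P5 z"
proof -
  assume "x + y + z = 3 * t"
  then have z: "z = 3 * t - x - y" by simp
  have "2 * P5 (2*t - x) + 2 * P5 (2*t - y) + 2 * P5 (2*t - z) = 2 * P5 x + 2 * P5 y + 2 * P5 z"
    unfolding two_times_P5 z by (simp add: power2_eq_square algebra_simps)
  then show "P5 (2*t - x) + P5 (2*t - y) + P5 (2*t - z) = P5 x + P5 y + P5 z" by simp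
next
  assume "x + y + z = 3 * t + 2"
  then have z: "z = 3 * t + 2 - x - y" by simp
  have "2 * P5 (x - 2*t - 1) + 2 * P5 (y - 2*t - 1) + 2 * P5 (z - 2*t - 1) =
      2 * P5 x + 2 * P5 y + 2 * P5 z"
    unfolding two_times_P5 z by (simp add: power2_eq_square algebra_simps)
  then show "P5 (x - 2*t - 1) + P5 (y - 2*t - 1) + P5 (z - 2*t - 1) = P5 x + P5 y + P5 z" by simp
qed

lemma P5_reflect12:
  "x + y + z + 3 * w = 6 * j + 1 \<Longrightarrow>
    P5 (x - j) + P5 (y - j) + P5 (z - j) + P5 (w - 3*j) = P5 x + P5 y + P5 z + P5 w"
  "x + y + z - 3 * w = 6 * j + 4 \<Longrightarrow>
    P5 (j + 1 - x) + P5 (j + 1 - y) + P5 (j + 1 - z) + P5 (w + 3*j + 2) = P5 x + P5 y + P5 z + P5 w"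
proof -
  assume "x + y + z + 3 * w = 6 * j + 1"
  then have z: "z = 6 * j + 1 - x - y - 3 * w" by simp
  have "2 * P5 (x - j) + 2 * P5 (y - j) + 2 * P5 (z - j) + 2 * P5 (w - 3*j) =
      2 * P5 x + 2 * P5 y + 2 * P5 z + 2 * P5 w"
    unfolding two_times_P5 z by (simp add: power2_eq_square algebra_simps)
  then show "P5 (x - j) + P5 (y - j) + P5 (z - j) + P5 (w - 3*j) = P5 x + P5 y + P5 z + P5 w"
    by simp
next
  assume "x + y + z - 3 * w = 6 * j + 4"
  then have z: "z = 6 * j + 4 - x - y + 3 * w" by simp
  have "2 * P5 (j + 1 - x) + 2 * P5 (j + 1 - y) + 2 * P5 (j + 1 - z) + 2 * P5 (w + 3*j + 2) =
      2 * P5 x + 2 * P5 y + 2 * P5 z + 2 * P5 w"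
    unfolding two_times_P5 z by (simp add: power2_eq_square algebra_simps)
  then show "P5 (j + 1 - x) + P5 (j + 1 - y) + P5 (j + 1 - z) + P5 (w + 3*j + 2) =
      P5 x + P5 y + P5 z + P5 w"
    by simp
qed

lemma P5_0: "P5 0 = 0"
  by (simp add: P5_def)

section \<open>Triples on which the reflections fail\<close>

definition sum4_nonzero :: "int \<Rightarrow> bool" where
  "sum4_nonzero n \<longleftrightarrow>
    (\<exists>x y z w. n = P5 x + P5 y + P5 z + P5 w \<and> x \<noteq> 0 \<and> y \<noteq> 0 \<and> z \<noteq> 0 \<and> w \<noteq> 0)"

text \<open>
  Reflecting the representation $(x,y,z,0)$ with respect to the variables $x, y, 0$ if
  $x + y \not\equiv 1 \pmod 3$, and with respect to all four with $z$ in the distinguished place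
  otherwise, produces a zero in exactly these cases.
\<close>

definition obstructed :: "int \<Rightarrow> int \<Rightarrow> int \<Rightarrow> bool" where
  "obstructed x y z \<longleftrightarrow>
    (if (x + y) mod 3 = 0 then x + y = 0 \<or> x = 2*y \<or> y = 2*x
     else if (x + y) mod 3 = 2 then x = 2*y - 1 \<or> y = 2*x - 1
     else if odd (x + y + z) then
       x + y + 3*z = 1 \<or> y + 3*z = 5*x + 1 \<or> x + 3*z = 5*y + 1 \<or> x + y + z = 1
     else x + y - 3*z = -2 \<or> y - 3*z = 5*x - 2 \<or> x - 3*z = 5*y - 2 \<or> x + y = z)"

text \<open>
  In each residue class the three conditions are systems of three linear equations; 10 bounds
  every solution of a nonsingular system, and the singular ones give the lines.
\<close>

lemma obstructed_classification:
  assumes obs: "obstructed x y z" "obstructed x z y" "obstructed y z x"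
    and sorted: "x mod 3 \<le> y mod 3" "y mod 3 \<le> z mod 3"
  shows "(- 10 \<le> x \<and> x \<le> 10 \<and> - 10 \<le> y \<and> y \<le> 10 \<and> - 10 \<le> z \<and> z \<le> 10) \<or>
    y mod 3 = 2 \<and> (x = 2*y \<and> z = y) \<or>
    x mod 3 = 1 \<and> (y = 2*x \<and> z = -x \<or> z = 2*x \<and> y = -x) \<or>
    x mod 3 = 0 \<and> (y = 2*x + 1 \<and> z = x + 1 \<or> z = 2*x + 1 \<and> y = x + 1 \<or>
      y = 1 - 2*x \<and> z = 1 - x \<or> z = 1 - 2*x \<and> y = 1 - x) \<or>
    x mod 3 = 0 \<and> y mod 3 = 0 \<and> (z = 1 \<and> x = -y \<or> x = 2*y \<and> z = 1 - 3*y \<or> y = 2*x \<and> z = 1 - 3*x)"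
    (is "?bounded \<or> _")
proof -
  define r s t where m: "r = x mod 3" "s = y mod 3" "t = z mod 3"
  have *: "(x + y) mod 3 = (r + s) mod 3" "(x + z) mod 3 = (r + t) mod 3" "(y + z) mod 3 = (s + t) mod 3"
    unfolding m by (simp_all add: mod_add_eq)
  have swap: "x + z + y = x + y + z" "y + z + x = x + y + z" by simp_all
  note obs' = obs[unfolded obstructed_def * swap]
  have "r = 0 \<or> r = 1 \<or> r = 2" "s = 0 \<or> s = 1 \<or> s = 2" "t = 0 \<or> t = 1 \<or> t = 2"
    unfolding m by presburger+
  \<comment> \<open>Sorting the residues cuts 27 patterns down to ten. Up to parity, the pattern
    decides which branch of \<open>obstructed\<close> applies to each pair.\<close>
  then consider (1) "r = 0" "s = 0" "t = 0"
    | (2) "r = 0" "s = 0" "t = 1"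
    | (3) "r = 0" "s = 0" "t = 2"
    | (4) "r = 0" "s = 1" "t = 1"
    | (5) "r = 0" "s = 1" "t = 2"
    | (6) "r = 0" "s = 2" "t = 2"
    | (7) "r = 1" "s = 1" "t = 1"
    | (8) "r = 1" "s = 1" "t = 2"
    | (9) "r = 1" "s = 2" "t = 2"
    | (10) "r = 2" "s = 2" "t = 2"
    using sorted unfolding m[symmetric] by (elim disjE) simp_all
  then show ?thesis
  proof cases
    case 1
    then have "x + y = 0 \<or> x = 2*y \<or> y = 2*x"
      "x + z = 0 \<or> x = 2*z \<or> z = 2*x"
      "y + z = 0 \<or> y = 2*z \<or> z = 2*y"
      using obs' by simp_all
    then have "?bounded"
      by (elim disjE) ((intro conjI; linarith)+)
    then show ?thesis using m 1 by auto
  next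
    case 2
    have "?bounded \<or>
        z = 1 \<and> x = -y \<or> x = 2*y \<and> z = 1 - 3*y \<or> y = 2*x \<and> z = 1 - 3*x"
    proof (cases "odd (x + y + z)")
      case True
      then have "x + y = 0 \<or> x = 2*y \<or> y = 2*x"
        "x + z + 3*y = 1 \<or> z + 3*y = 5*x + 1 \<or> x + 3*y = 5*z + 1 \<or> x + y + z = 1"
        "y + z + 3*x = 1 \<or> z + 3*x = 5*y + 1 \<or> y + 3*x = 5*z + 1 \<or> x + y + z = 1"
        using obs' unfolding 2 by simp_all
      then show ?thesis
        by (elim disjE) (((intro disjI1 conjI; linarith)
          | (rule disjI2, (intro disjI1 conjI; linarith))
          | (rule disjI2, rule disjI2, (intro disjI1 conjI; linarith))
          | (rule disjI2, rule disjI2, rule disjI2, (intro conjI; linarith)))+)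
    next
      case False
      then have "x + y = 0 \<or> x = 2*y \<or> y = 2*x"
        "x + z - 3*y = -2 \<or> z - 3*y = 5*x - 2 \<or> x - 3*y = 5*z - 2 \<or> x + z = y"
        "y + z - 3*x = -2 \<or> z - 3*x = 5*y - 2 \<or> y - 3*x = 5*z - 2 \<or> y + z = x"
        using obs' unfolding 2 by simp_all
      then show ?thesis
        by (elim disjE) (((intro disjI1 conjI; linarith)
          | (rule disjI2, (intro disjI1 conjI; linarith))
          | (rule disjI2, rule disjI2, (intro disjI1 conjI; linarith))
          | (rule disjI2, rule disjI2, rule disjI2, (intro conjI; linarith)))+)
    qed
    then show ?thesis using m 2 by auto
  next
    case 3
    then have "x + y = 0 \<or> x = 2*y \<or> y = 2*x"
      "x = 2*z - 1 \<or> z = 2*x - 1"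
      "y = 2*z - 1 \<or> z = 2*y - 1"
      using obs' by simp_all
    then have "?bounded"
      by (elim disjE) ((intro conjI; linarith)+)
    then show ?thesis using m 3 by auto
  next
    case 4
    \<comment> \<open>For odd \<open>x + y + z\<close> this equation would be a disjunct of two
      conditions and leave further lines. In case 10 it would be shared by all three and leave a
      whole plane. The residues exclude it both times.\<close>
    have ne: "x + y + z \<noteq> 1" using 4 m by presburger
    have "?bounded \<or>
        y = 2*x + 1 \<and> z = x + 1 \<or> z = 2*x + 1 \<and> y = x + 1 \<or>
        y = 1 - 2*x \<and> z = 1 - x \<or> z = 1 - 2*x \<and> y = 1 - x"
    proof (cases "odd (x + y + z)")
      case True
      then have "x + y + 3*z = 1 \<or> y + 3*z = 5*x + 1 \<or> x + 3*z = 5*y + 1"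
        "x + z + 3*y = 1 \<or> z + 3*y = 5*x + 1 \<or> x + 3*y = 5*z + 1"
        "y = 2*z - 1 \<or> z = 2*y - 1"
        using obs' ne unfolding 4 by simp_all
      then show ?thesis
        by (elim disjE) (((intro disjI1 conjI; linarith)
          | (rule disjI2, (intro disjI1 conjI; linarith))
          | (rule disjI2, rule disjI2, (intro disjI1 conjI; linarith))
          | (rule disjI2, rule disjI2, rule disjI2, (intro disjI1 conjI; linarith))
          | (rule disjI2, rule disjI2, rule disjI2, rule disjI2, (intro conjI; linarith)))+)
    next
      case False
      then have "x + y - 3*z = -2 \<or> y - 3*z = 5*x - 2 \<or> x - 3*z = 5*y - 2 \<or> x + y = z"
        "x + z - 3*y = -2 \<or> z - 3*y = 5*x - 2 \<or> x - 3*y = 5*z - 2 \<or> x + z = y"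
        "y = 2*z - 1 \<or> z = 2*y - 1"
        using obs' unfolding 4 by simp_all
      then show ?thesis
        by (elim disjE) (((intro disjI1 conjI; linarith)
          | (rule disjI2, (intro disjI1 conjI; linarith))
          | (rule disjI2, rule disjI2, (intro disjI1 conjI; linarith))
          | (rule disjI2, rule disjI2, rule disjI2, (intro disjI1 conjI; linarith))
          | (rule disjI2, rule disjI2, rule disjI2, rule disjI2, (intro conjI; linarith)))+)
    qed
    then show ?thesis using m 4 by auto
  next
    case 5
    have "?bounded"
    proof (cases "odd (x + y + z)")
      case True
      then have "x + y + 3*z = 1 \<or> y + 3*z = 5*x + 1 \<or> x + 3*z = 5*y + 1 \<or> x + y + z = 1"
        "x = 2*z - 1 \<or> z = 2*x - 1"
        "y + z = 0 \<or> y = 2*z \<or> z = 2*y"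
        using obs' unfolding 5 by simp_all
      then show ?thesis
        by (elim disjE) ((intro conjI; linarith)+)
    next
      case False
      then have "x + y - 3*z = -2 \<or> y - 3*z = 5*x - 2 \<or> x - 3*z = 5*y - 2 \<or> x + y = z"
        "x = 2*z - 1 \<or> z = 2*x - 1"
        "y + z = 0 \<or> y = 2*z \<or> z = 2*y"
        using obs' unfolding 5 by simp_all
      then show ?thesis
        by (elim disjE) ((intro conjI; linarith)+)
    qed
    then show ?thesis using m 5 by auto
  next
    case 6
    have "?bounded"
    proof (cases "odd (x + y + z)")
      case True
      then have "x = 2*y - 1 \<or> y = 2*x - 1"
        "x = 2*z - 1 \<or> z = 2*x - 1"
        "y + z + 3*x = 1 \<or> z + 3*x = 5*y + 1 \<or> y + 3*x = 5*z + 1 \<or> x + y + z = 1"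
        using obs' unfolding 6 by simp_all
      then show ?thesis
        by (elim disjE) ((intro conjI; linarith)+)
    next
      case False
      then have "x = 2*y - 1 \<or> y = 2*x - 1"
        "x = 2*z - 1 \<or> z = 2*x - 1"
        "y + z - 3*x = -2 \<or> z - 3*x = 5*y - 2 \<or> y - 3*x = 5*z - 2 \<or> y + z = x"
        using obs' unfolding 6 by simp_all
      then show ?thesis
        by (elim disjE) ((intro conjI; linarith)+)
    qed
    then show ?thesis using m 6 by auto
  next
    case 7
    then have "x = 2*y - 1 \<or> y = 2*x - 1"
      "x = 2*z - 1 \<or> z = 2*x - 1"
      "y = 2*z - 1 \<or> z = 2*y - 1"
      using obs' by simp_all
    then have "?bounded"
      by (elim disjE) ((intro conjI; linarith)+)
    then show ?thesis using m 7 by auto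
  next
    case 8
    then have "x = 2*y - 1 \<or> y = 2*x - 1"
      "x + z = 0 \<or> x = 2*z \<or> z = 2*x"
      "y + z = 0 \<or> y = 2*z \<or> z = 2*y"
      using obs' by simp_all
    then have "?bounded"
      by (elim disjE) ((intro conjI; linarith)+)
    then show ?thesis using m 8 by auto
  next
    case 9
    have "?bounded \<or>
        x = 2*y \<and> z = y \<or> y = 2*x \<and> z = -x \<or> z = 2*x \<and> y = -x"
    proof (cases "odd (x + y + z)")
      case True
      then have "x + y = 0 \<or> x = 2*y \<or> y = 2*x"
        "x + z = 0 \<or> x = 2*z \<or> z = 2*x"
        "y + z + 3*x = 1 \<or> z + 3*x = 5*y + 1 \<or> y + 3*x = 5*z + 1 \<or> x + y + z = 1"
        using obs' unfolding 9 by simp_all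
      then show ?thesis
        by (elim disjE) (((intro disjI1 conjI; linarith)
          | (rule disjI2, (intro disjI1 conjI; linarith))
          | (rule disjI2, rule disjI2, (intro disjI1 conjI; linarith))
          | (rule disjI2, rule disjI2, rule disjI2, (intro conjI; linarith)))+)
    next
      case False
      then have "x + y = 0 \<or> x = 2*y \<or> y = 2*x"
        "x + z = 0 \<or> x = 2*z \<or> z = 2*x"
        "y + z - 3*x = -2 \<or> z - 3*x = 5*y - 2 \<or> y - 3*x = 5*z - 2 \<or> y + z = x"
        using obs' unfolding 9 by simp_all
      then show ?thesis
        by (elim disjE) (((intro disjI1 conjI; linarith)
          | (rule disjI2, (intro disjI1 conjI; linarith))
          | (rule disjI2, rule disjI2, (intro disjI1 conjI; linarith))
          | (rule disjI2, rule disjI2, rule disjI2, (intro conjI; linarith)))+)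
    qed
    then show ?thesis using m 9 by auto
  next
    case 10
    have ne: "x + y + z \<noteq> 1" using 10 m by presburger
    have "?bounded"
    proof (cases "odd (x + y + z)")
      case True
      then have "x + y + 3*z = 1 \<or> y + 3*z = 5*x + 1 \<or> x + 3*z = 5*y + 1"
        "x + z + 3*y = 1 \<or> z + 3*y = 5*x + 1 \<or> x + 3*y = 5*z + 1"
        "y + z + 3*x = 1 \<or> z + 3*x = 5*y + 1 \<or> y + 3*x = 5*z + 1"
        using obs' ne unfolding 10 by simp_all
      then show ?thesis
        by (elim disjE) ((intro conjI; linarith)+)
    next
      case False
      then have "x + y - 3*z = -2 \<or> y - 3*z = 5*x - 2 \<or> x - 3*z = 5*y - 2 \<or> x + y = z"
        "x + z - 3*y = -2 \<or> z - 3*y = 5*x - 2 \<or> x - 3*y = 5*z - 2 \<or> x + z = y"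
        "y + z - 3*x = -2 \<or> z - 3*x = 5*y - 2 \<or> y - 3*x = 5*z - 2 \<or> y + z = x"
        using obs' unfolding 10 by simp_all
      then show ?thesis
        by (elim disjE) ((intro conjI; linarith)+)
    qed
    then show ?thesis using m 10 by auto
  qed
qed

section \<open>Bounding an \<open>n\<close> that is not a sum of four nonzero values\<close>

locale no_sum4_nonzero =
  fixes n :: int
  assumes not_sum4_nonzero: "\<not> sum4_nonzero n"
begin

text \<open>Applied to a reflected representation, this turns the hypothesis on \<open>n\<close>
  into linear equations for the original variables.\<close>

lemma has_zero: "n = P5 x + P5 y + P5 z + P5 w \<Longrightarrow> x = 0 \<or> y = 0 \<or> z = 0 \<or> w = 0"
  using not_sum4_nonzero unfolding sum4_nonzero_def by blast

lemma obstructed: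
  assumes n: "n = P5 x + P5 y + P5 z" and "z \<noteq> 0"
  shows "obstructed x y z"
proof -
  consider t where "x + y + 0 = 3 * t" | t where "x + y + 0 = 3 * t + 2"
    | j where "x + y + 0 + 3 * z = 6 * j + 1" | j where "x + y + 0 - 3 * z = 6 * j + 4"
  proof -
    show thesis
    proof (cases "x + y" rule: int_mod3_cases)
      case (2 u)
      \<comment> \<open>Now \<open>x + y + 3*z = 3*(u + z) + 1\<close> and
        \<open>x + y - 3*z = 3*(u - z) + 1\<close>, so the parity of \<open>u + z\<close> selects
        the sign in $(1,1,1,\<plusminus>3)$.\<close>
      show thesis
      proof (cases "even (u + z)")
        case True
        then obtain j where "u + z = 2 * j" by blast
        with 2 show thesis by (intro that(3)[of j]) simp
      next
        case False
        then have "odd (u - z)" by simp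
        then obtain j where "u - z = 2 * j + 1" by (rule oddE)
        with 2 show thesis by (intro that(4)[of j]) simp
      qed
    qed (use that in auto)
  qed
  then show ?thesis
  proof cases
    case 1
    have "2*t - x = 0 \<or> 2*t - y = 0 \<or> 2*t - 0 = 0 \<or> z = 0"
      by (rule has_zero) (use P5_reflect3(1)[OF 1] n P5_0 in simp)
    moreover have "(x + y) mod 3 = 0" using 1 by simp
    ultimately show ?thesis using 1 \<open>z \<noteq> 0\<close> unfolding obstructed_def by auto
  next
    case 2
    have "x - 2*t - 1 = 0 \<or> y - 2*t - 1 = 0 \<or> 0 - 2*t - 1 = 0 \<or> z = 0"
      by (rule has_zero) (use P5_reflect3(2)[OF 2] n P5_0 in simp)
    moreover have "(x + y) mod 3 = 2" using 2 by presburger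
    \<comment> \<open>The zero becomes an odd number, so this branch of \<open>obstructed\<close>
      has only two disjuncts.\<close>
    moreover have "0 - 2*t - 1 \<noteq> 0" by presburger
    ultimately show ?thesis using 2 \<open>z \<noteq> 0\<close> unfolding obstructed_def by auto
  next
    case 3
    have "x - j = 0 \<or> y - j = 0 \<or> 0 - j = 0 \<or> z - 3*j = 0"
      by (rule has_zero) (use P5_reflect12(1)[OF 3] n P5_0 in simp)
    moreover have "(x + y) mod 3 = 1" "odd (x + y + z)" using 3 by presburger+
    ultimately show ?thesis using 3 unfolding obstructed_def by auto
  next
    case 4
    have "j + 1 - x = 0 \<or> j + 1 - y = 0 \<or> j + 1 - 0 = 0 \<or> z + 3*j + 2 = 0"
      by (rule has_zero) (use P5_reflect12(2)[OF 4] n P5_0 in simp)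
    moreover have "(x + y) mod 3 = 1" "even (x + y + z)" using 4 by presburger+
    ultimately show ?thesis using 4 unfolding obstructed_def by auto
  qed
qed

lemma obstructed3:
  assumes "n = P5 x + P5 y + P5 z" "x \<noteq> 0" "y \<noteq> 0" "z \<noteq> 0"
  shows "obstructed x y z" "obstructed x z y" "obstructed y z x"
  using obstructed[of x y z] obstructed[of x z y] obstructed[of y z x] assms by simp_all

text \<open>
  Each of the lines left over by the classification is handled by one more reflection: it leads
  to a triple on another line, and some pair of its entries is not obstructed.
\<close>

lemma not_line1:
  shows "n \<noteq> P5 (6*s + 4) + P5 (3*s + 2) + P5 (3*s + 2)"
proof
  assume n: "n = P5 (6*s + 4) + P5 (3*s + 2) + P5 (3*s + 2)"
  \<comment> \<open>Here and for the next three lines, the three nonzero summands are reflected and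
    the zero stays, so \<open>obstructed3\<close> gives new conditions on the new triple.\<close>
  have *: "n = P5 (-2*s - 1) + P5 (-3 - 5*s) + P5 (-3 - 5*s)"
    using P5_reflect3(2)[of "6*s + 4" "3*s + 2" "3*s + 2" "4*s + 2"] n
    by (simp add: P5_0 algebra_simps)
  have "-2*s - 1 \<noteq> 0" "-3 - 5*s \<noteq> 0" "-3 - 5*s \<noteq> 0" by presburger+
  from obstructed3[OF * this] show False unfolding obstructed_def by (smt (z3))
qed

lemma not_line2:
  assumes s: "s \<noteq> 0"
  shows "n \<noteq> P5 (6*s + 2) + P5 (3*s + 1) + P5 (-1 - 3*s)"
proof
  assume n: "n = P5 (6*s + 2) + P5 (3*s + 1) + P5 (-1 - 3*s)"
  have *: "n = P5 (1 + 2*s) + P5 (-s) + P5 (-2 - 7*s)"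
    using P5_reflect3(2)[of "6*s + 2" "3*s + 1" "-1 - 3*s" "2*s"] n
    by (simp add: P5_0 algebra_simps)
  have "1 + 2*s \<noteq> 0" "-s \<noteq> 0" "-2 - 7*s \<noteq> 0" using s by presburger+
  from obstructed3[OF * this] s show False unfolding obstructed_def by (smt (z3))
qed

lemma not_line3:
  assumes s: "s \<noteq> 0"
  shows "n \<noteq> P5 (6*s + 1) + P5 (3*s) + P5 (3*s + 1)"
proof
  assume n: "n = P5 (6*s + 1) + P5 (3*s) + P5 (3*s + 1)"
  have *: "n = P5 (-2*s) + P5 (-5*s - 1) + P5 (-5*s)"
    using P5_reflect3(2)[of "6*s + 1" "3*s" "3*s + 1" "4*s"] n
    by (simp add: P5_0 algebra_simps)
  have "-2*s \<noteq> 0" "-5*s - 1 \<noteq> 0" "-5*s \<noteq> 0" using s by presburger+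
  from obstructed3[OF * this] s show False unfolding obstructed_def by (smt (z3))
qed

lemma not_line4:
  assumes s: "s \<noteq> 0"
  shows "n \<noteq> P5 (6*s + 1) + P5 (3*s + 1) + P5 (-3*s)"
proof
  assume n: "n = P5 (6*s + 1) + P5 (3*s + 1) + P5 (-3*s)"
  have *: "n = P5 (2*s) + P5 (-s) + P5 (-7*s - 1)"
    using P5_reflect3(2)[of "6*s + 1" "3*s + 1" "-3*s" "2*s"] n
    by (simp add: P5_0 algebra_simps)
  have "2*s \<noteq> 0" "-s \<noteq> 0" "-7*s - 1 \<noteq> 0" using s by presburger+
  from obstructed3[OF * this] s show False unfolding obstructed_def by (smt (z3))
qed

lemma not_line5:
  assumes s: "s \<noteq> 0" "s \<noteq> -1"
  shows "n \<noteq> P5 1 + P5 (3*s) + P5 (-3*s)"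
proof
  assume n: "n = P5 1 + P5 (3*s) + P5 (-3*s)"
  \<comment> \<open>With the zero among the first three variables, the reflection makes the
    distinguished one vanish: \<open>-3*s - 3*(-s) = 0\<close>. The last line is treated in the same
    way.\<close>
  have *: "n = P5 (1 + s) + P5 (4*s) + P5 s"
    using P5_reflect12(1)[of "1" "3*s" 0 "-3*s" "-s"] n
    by (simp add: P5_0 algebra_simps)
  have "1 + s \<noteq> 0" "4*s \<noteq> 0" "s \<noteq> 0" using s by presburger+
  from obstructed3[OF * this] s show False unfolding obstructed_def by (smt (z3))
qed

lemma not_line6:
  assumes s: "s \<noteq> 0"
  shows "n \<noteq> P5 (1 - 9*s) + P5 (3*s) + P5 (6*s)"
proof
  assume n: "n = P5 (1 - 9*s) + P5 (3*s) + P5 (6*s)"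
  have *: "n = P5 (1 - 10*s) + P5 (5*s) + P5 (-s)"
    using P5_reflect12(1)[of "1 - 9*s" "6*s" 0 "3*s" s] n
    by (simp add: P5_0 algebra_simps)
  have "1 - 10*s \<noteq> 0" "5*s \<noteq> 0" "-s \<noteq> 0" using s by presburger+
  from obstructed3[OF * this] s show False unfolding obstructed_def by (smt (z3))
qed

text \<open>Points on the six lines are contradictory except for parameters excluded above, and
  those triples lie in the bounded set.\<close>

lemma triple_le_sorted:
  assumes n: "n = P5 x + P5 y + P5 z" and nz: "x \<noteq> 0" "y \<noteq> 0" "z \<noteq> 0"
    and sorted: "x mod 3 \<le> y mod 3" "y mod 3 \<le> z mod 3"
  shows "n \<le> 465"
proof -
  have line1': False if h: "y mod 3 = 2" "x = 2*y" "z = y"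
  proof -
    obtain s where "y = 3*s + 2" using h(1) by (metis mult_div_mod_eq)
    then show False using not_line1[of s] n h by simp
  qed
  have line2': False if h: "u mod 3 = 1" "u \<noteq> 1" "n = P5 (2*u) + P5 u + P5 (-u)" for u
  proof -
    obtain s where "u = 3*s + 1" using h(1) by (metis mult_div_mod_eq)
    then show False using not_line2[of s] h by (simp add: algebra_simps)
  qed
  have line346': False if h: "x mod 3 = 0"
    "n = P5 x + P5 (2*x + 1) + P5 (x + 1) \<or> n = P5 x + P5 (1 - 2*x) + P5 (1 - x) \<or>
      n = P5 x + P5 (2*x) + P5 (1 - 3*x)" "x \<noteq> 0" for x
  proof -
    obtain s where s: "x = 3*s" using h(1) by (metis mult_div_mod_eq add.right_neutral)
    then show False
      using h(2,3) not_line3[of s] not_line4[of "-s"] not_line6[of s] by (auto simp: algebra_simps)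
  qed
  have line5': False if h: "x mod 3 = 0" "x \<noteq> 0" "x \<noteq> -3" "n = P5 1 + P5 x + P5 (-x)" for x
  proof -
    obtain s where s: "x = 3*s" using h(1) by (metis mult_div_mod_eq add.right_neutral)
    then show False using h not_line5[of s] by simp
  qed
  have bounded: "n \<le> 465" if "- 10 \<le> x \<and> x \<le> 10 \<and> - 10 \<le> y \<and> y \<le> 10 \<and> - 10 \<le> z \<and> z \<le> 10"
    using that P5_le[of x] P5_le[of y] P5_le[of z] n by linarith
  show ?thesis
    using obstructed_classification[OF obstructed3[OF n nz] sorted]
  proof (elim disjE conjE)
    assume "y mod 3 = 2" "x = 2*y" "z = y"
    then show ?thesis using line1' by blast
  next
    assume "x mod 3 = 1" "y = 2*x" "z = -x"
    \<comment> \<open>\<open>x = 1\<close> is the parameter \<open>s = 0\<close> excluded in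
      \<open>not_line2\<close>.\<close>
    then show ?thesis using line2'[of x] n bounded by (cases "x = 1") auto
  next
    assume "x mod 3 = 1" "z = 2*x" "y = -x"
    then show ?thesis using line2'[of x] n bounded by (cases "x = 1") auto
  next
    assume "x mod 3 = 0" "y = 2*x + 1" "z = x + 1"
    then show ?thesis using line346'[of x] n nz by simp
  next
    assume "x mod 3 = 0" "z = 2*x + 1" "y = x + 1"
    then show ?thesis using line346'[of x] n nz by simp
  next
    assume "x mod 3 = 0" "y = 1 - 2*x" "z = 1 - x"
    then show ?thesis using line346'[of x] n nz by simp
  next
    assume "x mod 3 = 0" "z = 1 - 2*x" "y = 1 - x"
    then show ?thesis using line346'[of x] n nz by simp
  next
    assume "y mod 3 = 0" "z = 1" "x = -y"
    \<comment> \<open>\<open>y = -3\<close> is the parameter \<open>s = -1\<close> excluded in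
      \<open>not_line5\<close>.\<close>
    then show ?thesis using line5'[of y] n nz bounded by (cases "y = -3") auto
  next
    assume "y mod 3 = 0" "x = 2*y" "z = 1 - 3*y"
    then show ?thesis using line346'[of y] n nz by simp
  next
    assume "x mod 3 = 0" "y = 2*x" "z = 1 - 3*x"
    then show ?thesis using line346'[of x] n nz by simp
  qed (use bounded in blast)
qed

text \<open>The claim is symmetric in \<open>x\<close>, \<open>y\<close>, \<open>z\<close>, so the
  residues may be taken in increasing order.\<close>

lemma triple_le:
  assumes n: "n = P5 x + P5 y + P5 z" and nz: "x \<noteq> 0" "y \<noteq> 0" "z \<noteq> 0"
  shows "n \<le> 465"
proof -
  have perms: "n = P5 x + P5 z + P5 y" "n = P5 y + P5 x + P5 z" "n = P5 y + P5 z + P5 x"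
    "n = P5 z + P5 x + P5 y" "n = P5 z + P5 y + P5 x"
    using n by simp_all
  show ?thesis
    by (rule le_cases3[of "x mod 3" "y mod 3" "z mod 3"])
      (rule triple_le_sorted; (rule n perms nz | assumption))+
qed

section \<open>Representations with one or two nonzero summands\<close>

text \<open>In the other residue classes, reflecting \<open>x\<close> together with the two zeros
  makes all three nonzero; only \<open>x = -1\<close> escapes.\<close>

lemma pair_residue:
  assumes n: "n = P5 x + P5 y" and "x \<noteq> 0" "y \<noteq> 0" "x \<noteq> -1"
  obtains u where "x = 3*u + 1"
proof -
  have False if "x = 3*t" for t
  proof -
    have "n = P5 (-t) + P5 (2*t) + P5 (2*t) + P5 y"
      using P5_reflect3(1)[of x 0 0 t] n that by (simp add: P5_0)
    then show False using has_zero assms that by fastforce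
  qed
  moreover have False if "x = 3*t + 2" for t
  proof -
    have "n = P5 (t + 1) + P5 (-2*t - 1) + P5 (-2*t - 1) + P5 y"
      using P5_reflect3(2)[of x 0 0 t] n that by (simp add: P5_0 algebra_simps)
    then have "t + 1 = 0 \<or> -2*t - 1 = 0" using has_zero assms by fastforce
    moreover have "-2*t - 1 \<noteq> 0" by presburger
    ultimately show False using assms(4) that by simp
  qed
  ultimately show thesis using that by (metis int_mod3_cases)
qed

text \<open>Reflect \<open>(x, 0, 0, y)\<close> with \<open>y\<close> distinguished: each equation
  says that a new entry vanishes. With the roles exchanged as well, this bounds all pairs with
  \<open>x \<noteq> y\<close>.\<close>

lemma pair_mod_3_eq_1:
  assumes n: "n = P5 x + P5 y" and "y \<noteq> 0" and u: "x = 3*u + 1" and v: "y = 3*v + 1"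
  shows "x + 3*y = 1 \<or> 3*y = 5*x + 1 \<or> x - 3*y = -2 \<or> 5*x + 3*y = 2 \<or> x = y"
proof (cases "even (u + y)")
  case True
  then obtain j where "u + y = 2*j" by blast
  then have j: "x + 0 + 0 + 3*y = 6*j + 1" using u by simp
  have "x - j = 0 \<or> -j = 0 \<or> -j = 0 \<or> y - 3*j = 0"
    by (rule has_zero) (use P5_reflect12(1)[OF j] n in \<open>simp add: P5_0\<close>)
  moreover have "y - 3*j \<noteq> 0" using v by presburger
  ultimately show ?thesis using j by auto
next
  case False
  then have "odd (u - y)" by simp
  then obtain j where "u - y = 2*j + 1" by (rule oddE)
  then have j: "x + 0 + 0 - 3*y = 6*j + 4" using u by simp
  have "j + 1 - x = 0 \<or> j + 1 = 0 \<or> j + 1 = 0 \<or> y + 3*j + 2 = 0"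
    by (rule has_zero) (use P5_reflect12(2)[OF j] n in \<open>simp add: P5_0\<close>)
  then show ?thesis using j by auto
qed

lemma pair_le:
  assumes n: "n = P5 x + P5 y" and nz: "x \<noteq> 0" "y \<noteq> 0"
  shows "n \<le> 465"
proof -
  have n': "n = P5 y + P5 x" using n by simp
  \<comment> \<open>The exception in \<open>pair_residue\<close>: reflecting
    \<open>(-1, y, 0)\<close> gives a triple without zeros, apart from two small cases.\<close>
  have minus_one: "n \<le> 465" if h: "n = P5 (-1) + P5 y" "y \<noteq> 0" "y \<noteq> -1" for y
  proof -
    obtain u where u: "y = 3*u + 1"
      by (rule pair_residue[of y "-1"]) (use h in auto)
    have *: "n = P5 (2*u + 1) + P5 (-1 - u) + P5 (2*u)"
      using P5_reflect3(1)[of "-1" y 0 u] h u by (simp add: P5_0 algebra_simps)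
    show ?thesis
    proof (cases "u = 0 \<or> u = -1")
      case True
      then show ?thesis using * by (auto simp: P5_def)
    next
      case False
      moreover have "2*u + 1 \<noteq> 0" by presburger
      ultimately show ?thesis using triple_le[OF *] by simp
    qed
  qed
  consider "x = -1" "y = -1" | "x = -1" "y \<noteq> -1" | "x \<noteq> -1" "y = -1" | "x \<noteq> -1" "y \<noteq> -1" by blast
  then show ?thesis
  proof cases
    case 1
    then show ?thesis using n by (simp add: P5_def)
  next
    case 2
    then show ?thesis using minus_one[of y] n nz by simp
  next
    case 3
    then show ?thesis using minus_one[of x] n' nz by simp
  next
    case 4
    obtain u where u: "x = 3*u + 1" by (rule pair_residue[OF n nz 4(1)])
    obtain v where v: "y = 3*v + 1" by (rule pair_residue[OF n' nz(2,1) 4(2)])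
    show ?thesis
    proof (cases "x = y")
      case True
      \<comment> \<open>The remaining family \<open>x = y\<close> is reflected, together with one
        zero, to a triple.\<close>
      have *: "n = P5 (-u) + P5 (-u) + P5 (-4*u - 1)"
        using P5_reflect3(2)[of x x 0 "2*u"] n u True by (simp add: P5_0 algebra_simps)
      show ?thesis
      proof (cases "u = 0")
        case True
        then show ?thesis using * by (simp add: P5_def)
      next
        case False
        moreover have "-4*u - 1 \<noteq> 0" by presburger
        ultimately show ?thesis using triple_le[OF *] by simp
      qed
    next
      case False
      then have "- 10 \<le> x \<and> x \<le> 10 \<and> - 10 \<le> y \<and> y \<le> 10"
        using pair_mod_3_eq_1[OF n nz(2) u v] pair_mod_3_eq_1[OF n' nz(1) v u] by linarith
      then show ?thesis using P5_le[of x] P5_le[of y] n by linarith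
    qed
  qed
qed

text \<open>Reflecting \<open>x\<close> with zeros gives a nonzero triple or, if
  \<open>x mod 3 = 1\<close>, four nonzero summands; the exceptions are \<open>x = -1\<close>,
  \<open>x = 1\<close> and \<open>x = -2\<close>.\<close>

lemma single_le:
  assumes n: "n = P5 x" and nz: "x \<noteq> 0"
  shows "n \<le> 465"
proof -
  consider t where "x = 3*t" | t where "x = 3*t + 2" | j where "x = 6*j + 1" | j where "x = 6*j + 4"
  proof (cases x rule: int_mod3_cases)
    case (2 u)
    show thesis
    proof (cases "even u")
      case True
      then obtain j where "u = 2*j" by blast
      then show thesis using 2 that(3)[of j] by simp
    next
      case False
      then obtain j where "u = 2*j + 1" by (rule oddE)
      then show thesis using 2 that(4)[of j] by simp
    qed
  qed (use that in blast)+
  then show ?thesis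
  proof cases
    case 1
    have *: "n = P5 (-t) + P5 (2*t) + P5 (2*t)"
      using P5_reflect3(1)[of x 0 0 t] n 1 by (simp add: P5_0)
    show ?thesis using triple_le[OF *] nz 1 by simp
  next
    case 2
    have *: "n = P5 (t + 1) + P5 (-2*t - 1) + P5 (-2*t - 1)"
      using P5_reflect3(2)[of x 0 0 t] n 2 by (simp add: P5_0 algebra_simps)
    have "-2*t - 1 \<noteq> 0" by presburger
    then show ?thesis using triple_le[OF *] n 2 by (cases "t = -1") (auto simp: P5_def)
  next
    case 3
    have "n = P5 (5*j + 1) + P5 (-j) + P5 (-j) + P5 (-3*j)"
      using P5_reflect12(1)[of x 0 0 0 j] n 3 by (simp add: P5_0 algebra_simps)
    from has_zero[OF this] have "j = 0 \<or> 5*j + 1 = 0" by auto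
    moreover have "5*j + 1 \<noteq> 0" by presburger
    ultimately show ?thesis using n 3 by (simp add: P5_def)
  next
    case 4
    have "n = P5 (-3 - 5*j) + P5 (j + 1) + P5 (j + 1) + P5 (3*j + 2)"
      using P5_reflect12(2)[of x 0 0 0 j] n 4 by (simp add: P5_0 algebra_simps)
    from has_zero[OF this] have "-3 - 5*j = 0 \<or> j = -1 \<or> 3*j + 2 = 0" by auto
    moreover have "-3 - 5*j \<noteq> 0" "3*j + 2 \<noteq> 0" by presburger+
    ultimately show ?thesis using n 4 by (simp add: P5_def)
  qed
qed

lemma triple_le':
  assumes n: "n = P5 x + P5 y + P5 z"
  shows "n \<le> 465"
proof -
  consider "x \<noteq> 0" "y \<noteq> 0" "z \<noteq> 0" | "x = 0" "y \<noteq> 0" "z \<noteq> 0" | "x \<noteq> 0" "y = 0" "z \<noteq> 0"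
    | "x \<noteq> 0" "y \<noteq> 0" "z = 0" | "x = 0" "y = 0" "z \<noteq> 0" | "x = 0" "y \<noteq> 0" "z = 0"
    | "x \<noteq> 0" "y = 0" "z = 0" | "x = 0" "y = 0" "z = 0"
    by blast
  then show ?thesis
  proof cases
    case 1
    then show ?thesis using triple_le n by blast
  next
    case 2
    then show ?thesis using pair_le[of y z] n by (simp add: P5_0)
  next
    case 3
    then show ?thesis using pair_le[of x z] n by (simp add: P5_0)
  next
    case 4
    then show ?thesis using pair_le[of x y] n by (simp add: P5_0)
  next
    case 5
    then show ?thesis using single_le[of z] n by (simp add: P5_0)
  next
    case 6
    then show ?thesis using single_le[of y] n by (simp add: P5_0)
  next
    case 7
    then show ?thesis using single_le[of x] n by (simp add: P5_0)
  next
    case 8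
    then show ?thesis using n by (simp add: P5_0)
  qed
qed

lemma sum4_le:
  assumes n: "n = P5 x + P5 y + P5 z + P5 w"
  shows "n \<le> 465"
  using has_zero[OF n] n triple_le'[of y z w] triple_le'[of x z w] triple_le'[of x y w] triple_le'[of x y z]
  by (auto simp: P5_0)

end

section \<open>Sums of four nonzero pentagonal numbers\<close>

lemma not_sum4_nonzero_le:
  assumes "\<not> sum4_nonzero n" "n = P5 x + P5 y + P5 z + P5 w"
  shows "n \<le> 465"
  using assms no_sum4_nonzero.sum4_le no_sum4_nonzero.intro by blast

section \<open>Existence of representations by four generalized pentagonal numbers\<close>

lemma square_eq_P5:
  fixes e :: int
  assumes "odd e" "\<not> 3 dvd e"
  obtains x where "e\<^sup>2 = 24 * P5 x + 1"
proof -
  have sq: "(6 * x - 1)\<^sup>2 = 24 * P5 x + 1" for x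
    using two_times_P5[of x] by (simp add: power2_eq_square algebra_simps)
  have "e mod 6 = 1 \<or> e mod 6 = 5" using assms by presburger
  then obtain x where "e = 6 * x - 1 \<or> e = - (6 * x - 1)"
  proof
    assume "e mod 6 = 1"
    then show thesis using that[of "- (e div 6)"] mult_div_mod_eq[of 6 e] by simp
  next
    assume "e mod 6 = 5"
    then show thesis using that[of "e div 6 + 1"] mult_div_mod_eq[of 6 e] by simp
  qed
  then have "e\<^sup>2 = (6 * x - 1)\<^sup>2" by (auto simp: power2_eq_iff)
  then show thesis using that sq by metis
qed

text \<open>A change of sign turns residue 2 into 1; then \<open>r\<close> is also the residue of
  the square modulo 3.\<close>

lemma sign_mod_3:
  fixes a :: int
  obtains a' q r where "a'\<^sup>2 = a\<^sup>2" "a' = 3 * q + r" "r = 0 \<or> r = 1"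
proof (cases a rule: int_mod3_cases)
  case (1 u)
  then show ?thesis using that[of a u 0] by simp
next
  case (2 u)
  then show ?thesis using that[of a u 1] by simp
next
  case (3 u)
  show ?thesis
  proof (rule that)
    show "(- a)\<^sup>2 = a\<^sup>2" "- a = 3 * (- u - 1) + 1" using 3 by (simp_all only: power2_minus) simp
  qed simp
qed

lemma four_pentagonals:
  assumes "0 \<le> n"
  obtains x y z w where "n = P5 x + P5 y + P5 z + P5 w"
proof -
  obtain a0 b0 c0 d0 :: int where "6 * n + 1 = a0\<^sup>2 + b0\<^sup>2 + c0\<^sup>2 + d0\<^sup>2"
    using four_squares[of "nat (6 * n + 1)"] assms unfolding sum4sq_def by auto
  moreover obtain a q1 r1 where a: "a\<^sup>2 = a0\<^sup>2" "a = 3 * q1 + r1" "r1 = 0 \<or> r1 = 1" by (rule sign_mod_3)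
  moreover obtain b q2 r2 where b: "b\<^sup>2 = b0\<^sup>2" "b = 3 * q2 + r2" "r2 = 0 \<or> r2 = 1" by (rule sign_mod_3)
  moreover obtain c q3 r3 where c: "c\<^sup>2 = c0\<^sup>2" "c = 3 * q3 + r3" "r3 = 0 \<or> r3 = 1" by (rule sign_mod_3)
  moreover obtain d q4 r4 where d: "d\<^sup>2 = d0\<^sup>2" "d = 3 * q4 + r4" "r4 = 0 \<or> r4 = 1" by (rule sign_mod_3)
  ultimately have m: "6 * n + 1 = a\<^sup>2 + b\<^sup>2 + c\<^sup>2 + d\<^sup>2" by simp
  have "odd (a\<^sup>2 + b\<^sup>2 + c\<^sup>2 + d\<^sup>2)" unfolding m[symmetric] by simp
  then have odd: "odd (a + b + c + d)" by simp
  define e1 e2 e3 e4 where e: "e1 = a + b + c - d" "e2 = a + b - c + d" "e3 = a - b + c + d"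
    "e4 = - a + b + c + d"
  have sum: "e1\<^sup>2 + e2\<^sup>2 + e3\<^sup>2 + e4\<^sup>2 = 4 * (6 * n + 1)"
    unfolding m e by (simp add: power2_eq_square algebra_simps)
  have odds: "odd e1" "odd e2" "odd e3" "odd e4" using odd unfolding e by presburger+
  have sq: "u\<^sup>2 = 3 * (3 * q\<^sup>2 + 2 * q * r) + r" if "u = 3 * q + r" "r = 0 \<or> r = 1" for u q r :: int
    using that by (auto simp: power2_eq_square algebra_simps)
  define k where "k = (3 * q1\<^sup>2 + 2 * q1 * r1) + (3 * q2\<^sup>2 + 2 * q2 * r2) + (3 * q3\<^sup>2 + 2 * q3 * r3) +
      (3 * q4\<^sup>2 + 2 * q4 * r4)"
  have "6 * n + 1 = 3 * k + (r1 + r2 + r3 + r4)"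
    unfolding m sq[OF a(2,3)] sq[OF b(2,3)] sq[OF c(2,3)] sq[OF d(2,3)] k_def by simp
  then have r: "r1 + r2 + r3 + r4 = 3 * (2 * n - k) + 1" by simp
  have "r1 + r2 + r3 + r4 \<noteq> 0 \<and> r1 + r2 + r3 + r4 \<noteq> 2 \<and> r1 + r2 + r3 + r4 \<noteq> 3"
    unfolding r by presburger
  then have r': "r1 + r2 + r3 + r4 = 1 \<or> r1 + r2 + r3 + r4 = 4" 
    using a(3) b(3) c(3) d(3) by auto
  have e': "e1 = 3 * (q1 + q2 + q3 - q4) + (r1 + r2 + r3 - r4)"
    "e2 = 3 * (q1 + q2 - q3 + q4) + (r1 + r2 - r3 + r4)"
    "e3 = 3 * (q1 - q2 + q3 + q4) + (r1 - r2 + r3 + r4)"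
    "e4 = 3 * (- q1 + q2 + q3 + q4) + (- r1 + r2 + r3 + r4)"
    unfolding e a(2) b(2) c(2) d(2) by simp_all
  \<comment> \<open>If exactly one of the residues is 1, the signed sums in \<open>e'\<close> are 1
    or -1; if all four are, they equal 2.\<close>
  have not3: "\<not> 3 dvd 3 * q + s" if "s = 1 \<or> s = -1 \<or> s = 2" for q s :: int
    using that by presburger
  have "\<not> 3 dvd e1" "\<not> 3 dvd e2" "\<not> 3 dvd e3" "\<not> 3 dvd e4"
    unfolding e' by (rule not3; use r' a(3) b(3) c(3) d(3) in auto)+
  with odds obtain x y z w where "e1\<^sup>2 = 24 * P5 x + 1" "e2\<^sup>2 = 24 * P5 y + 1"
    "e3\<^sup>2 = 24 * P5 z + 1" "e4\<^sup>2 = 24 * P5 w + 1"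
    by (metis square_eq_P5)
  then show thesis using sum that[of x y z w] by simp
qed

section \<open>Counting summands\<close>

lemma sum_of_nonzero_ge:
  assumes "sum_of_nonzero_generalized_pentagonals k n"
  shows "int k \<le> n"
proof -
  obtain a where a: "\<forall>i<k. generalized_pentagonal (a i) \<and> a i \<noteq> 0" "n = (\<Sum>i<k. a i)"
    using assms unfolding sum_of_nonzero_generalized_pentagonals_def by blast
  have "1 \<le> a i" if "i < k" for i
    using a(1) that P5_nonneg unfolding generalized_pentagonal_def by (metis int_one_le_iff_zero_less order_le_less)
  then have "(\<Sum>i<k. 1) \<le> (\<Sum>i<k. a i)" by (intro sum_mono) simp
  then show ?thesis using a(2) by simp
qed

lemma sum_of_nonzero_Suc:
  assumes "sum_of_nonzero_generalized_pentagonals k n" "x \<noteq> 0"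
  shows "sum_of_nonzero_generalized_pentagonals (Suc k) (n + P5 x)"
proof -
  obtain a where a: "\<forall>i<k. generalized_pentagonal (a i) \<and> a i \<noteq> 0" "n = (\<Sum>i<k. a i)"
    using assms unfolding sum_of_nonzero_generalized_pentagonals_def by blast
  have "\<forall>i<Suc k. generalized_pentagonal ((a(k := P5 x)) i) \<and> (a(k := P5 x)) i \<noteq> 0"
    using a(1) assms(2) by (auto simp: less_Suc_eq P5_eq_0_iff generalized_pentagonal_def)
  moreover have "n + P5 x = (\<Sum>i<Suc k. (a(k := P5 x)) i)" using a(2) by simp
  ultimately show ?thesis unfolding sum_of_nonzero_generalized_pentagonals_def by blast
qed

lemma sum4_nonzero_imp:
  assumes "sum4_nonzero n"
  shows "sum_of_nonzero_generalized_pentagonals 4 n"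
proof -
  obtain x y z w where xyzw: "n = P5 x + P5 y + P5 z + P5 w" "x \<noteq> 0" "y \<noteq> 0" "z \<noteq> 0" "w \<noteq> 0"
    using assms unfolding sum4_nonzero_def by blast
  have "sum_of_nonzero_generalized_pentagonals 0 0"
    unfolding sum_of_nonzero_generalized_pentagonals_def by simp
  from sum_of_nonzero_Suc[OF sum_of_nonzero_Suc[OF sum_of_nonzero_Suc[OF sum_of_nonzero_Suc[OF this]]]] xyzw
  show ?thesis by (simp add: numeral_eq_Suc)
qed

section \<open>Small \<open>n\<close> by evaluation\<close>

text \<open>All nonzero generalized pentagonal numbers up to 465, as literals for evaluation; the
  next one is \<open>P5 18 = 477\<close>.\<close>

definition small_pentagonals :: "int list" where
  "small_pentagonals = [1, 2, 5, 7, 12, 15, 22, 26, 35, 40, 51, 57, 70, 77, 92, 100, 117, 126, 145,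
    155, 176, 187, 210, 222, 247, 260, 287, 301, 330, 345, 376, 392, 425, 442]"

lemma small_pentagonals:
  assumes "p \<in> set small_pentagonals"
  obtains x where "x \<noteq> 0" "p = P5 x"
proof -
  have eq: "small_pentagonals = map P5 [1, -1, 2, -2, 3, -3, 4, -4, 5, -5, 6, -6, 7, -7, 8, -8, 9, -9,
      10, -10, 11, -11, 12, -12, 13, -13, 14, -14, 15, -15, 16, -16, 17, -17]"
    (is "_ = map P5 ?xs")
    by (simp add: small_pentagonals_def P5_def)
  have "p \<in> P5 ` set ?xs" using assms unfolding eq set_map .
  then obtain x where "p = P5 x" "x \<in> set ?xs" by blast
  moreover have "0 \<notin> set ?xs" by simp
  ultimately show thesis using that by metis
qed

text \<open>
  The numbers 2, 14, 50, 4 are sums of two nonzero generalized pentagonal numbers, found by a greedy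
  search.
\<close>

lemma small_pentagonals_cover:
  "list_all (\<lambda>n. list_ex (\<lambda>a. list_ex (\<lambda>p. List.member small_pentagonals (n - a - p))
    small_pentagonals) [2, 14, 50, 4]) [4..465]"
  by code_simp

lemma sum4_nonzero_small:
  assumes "4 \<le> n" "n \<le> 465"
  shows "sum4_nonzero n"
proof -
  have "n \<in> set [4..465]" using assms by (simp only: set_upto atLeastAtMost_iff)
  then obtain a p where a: "a \<in> set [2, 14, 50, 4 :: int]" and p: "p \<in> set small_pentagonals"
    and q: "n - a - p \<in> set small_pentagonals"
    using small_pentagonals_cover unfolding list_all_iff list_ex_iff List.member_iff by blast
  obtain x where x: "x \<noteq> 0" "p = P5 x" using small_pentagonals[OF p] .
  obtain y where y: "y \<noteq> 0" "n - a - p = P5 y" using small_pentagonals[OF q] .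
  have "2 = P5 1 + P5 1" "14 = P5 (-2) + P5 (-2)" "50 = P5 5 + P5 (-3)" "4 = P5 (-1) + P5 (-1)"
    by (simp_all add: P5_def)
  then obtain z w where "z \<noteq> 0" "w \<noteq> 0" "a = P5 z + P5 w"
    using a by (auto intro: that[of 1 1] that[of "-2" "-2"] that[of 5 "-3"] that[of "-1" "-1"])
  then have "n = P5 x + P5 y + P5 z + P5 w \<and> x \<noteq> 0 \<and> y \<noteq> 0 \<and> z \<noteq> 0 \<and> w \<noteq> 0"
    using x y by simp
  then show ?thesis unfolding sum4_nonzero_def by blast
qed

lemma sum4_nonzero: "4 \<le> n \<Longrightarrow> sum4_nonzero n"
  using four_pentagonals[of n] not_sum4_nonzero_le[of n] sum4_nonzero_small[of n] by fastforce

theorem theorem4p4: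
  fixes k :: nat and n :: int
  assumes "k \<ge> 4" and "n > 0"
  shows "sum_of_nonzero_generalized_pentagonals k n \<longleftrightarrow> n \<notin> {1..int k - 1}"
proof
  assume "sum_of_nonzero_generalized_pentagonals k n"
  then show "n \<notin> {1..int k - 1}" using sum_of_nonzero_ge by fastforce
next
  assume "n \<notin> {1..int k - 1}"
  then have "int k \<le> n" using assms(2) by auto
  with assms(1) show "sum_of_nonzero_generalized_pentagonals k n"
  proof (induction k arbitrary: n rule: dec_induct)
    case base
    then show ?case using sum4_nonzero_imp sum4_nonzero by simp
  next
    case (step k)
    \<comment> \<open>From \<open>int (Suc k) \<le> n\<close> the induction hypothesis applies to
      \<open>n - 1\<close>.\<close>
    then have "sum_of_nonzero_generalized_pentagonals (Suc k) (n - 1 + P5 1)"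
      by (intro sum_of_nonzero_Suc) auto
    then show ?case by (simp add: P5_def)
  qed
qed

end
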